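(* For every positive integer $n$: (a) $\mathcal{J}_{10}(2n)$ and $\mathcal{J}_{10}(8n+3)$ are even; (b) for each $i\in\{0,1,2\}$, $\mathcal{J}^*_{10}(4n+i)$ is even.
   Context: Let $q=e^{2\pi i\tau}$, $(a;q)_\infty=\prod_{j\ge0}(1-aq^j)$, and $\eta(\tau)=q^{1/24}(q;q)_\infty$. Define $$j_{10}(\tau)=\frac{\eta(2\tau)\eta(5\tau)^5}{\eta(\tau)\eta(10\tau)^5}-1=\frac1q+\sum_{n\ge0}\mathcal{J}_{10}(n)q^n,$$ $$j_{10}^{*}(\tau)=\left(\frac{\eta(\tau)\eta(5\tau)}{\eta(2\tau)\eta(10\tau)}\right)^{4}+4+2^4\left(\frac{\eta(2\tau)\eta(10\tau)}{\eta(\tau)\eta(5\tau)}\right)^{4}=\frac1q+\sum_{n\ge0}\mathcal{J}^*_{10}(n)q^n.$$ *)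

theory Defs
  imports "HOL-Computational_Algebra.Computational_Algebra"
begin

(* (q^k;q^k)_\<infinity> = \<Prod>_{j\<ge>1} (1 - q^(k j)) as a formal power series in q.
   Its N-th coefficient is the N-th coefficient of the finite product over j = 1..N
   (the factors with j > N are 1 modulo q^(N+1) when k \<ge> 1). *)
definition qpoch :: "nat \<Rightarrow> rat fps" where
  "qpoch k = Abs_fps (\<lambda>N. fps_nth (\<Prod>j\<in>{1..N}. (1 - fps_X ^ (k * j))) N)"

definition QP :: "nat \<Rightarrow> rat fls" where
  "QP k = fps_to_fls (qpoch k)"

(* j_10 = \<eta>(2\<tau>)\<eta>(5\<tau>)^5 / (\<eta>(\<tau>)\<eta>(10\<tau>)^5) - 1; the q^(1/24)-powers combine to q^(-1). *)
definition j10 :: "rat fls" where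
  "j10 = fls_X_inv * (QP 2 * QP 5 ^ 5 / (QP 1 * QP 10 ^ 5)) - 1"

(* j_10^* = (\<eta>(\<tau>)\<eta>(5\<tau>)/(\<eta>(2\<tau>)\<eta>(10\<tau>)))^4 + 4 + 2^4 (\<eta>(2\<tau>)\<eta>(10\<tau>)/(\<eta>(\<tau>)\<eta>(5\<tau>)))^4;
   the q^(1/24)-powers combine to q^(-1) and q^1 respectively. *)
definition j10star :: "rat fls" where
  "j10star = fls_X_inv * (QP 1 * QP 5 / (QP 2 * QP 10)) ^ 4 + 4
             + 2 ^ 4 * (fls_X * (QP 2 * QP 10 / (QP 1 * QP 5)) ^ 4)"

definition J10 :: "nat \<Rightarrow> rat" where
  "J10 n = fls_nth j10 (int n)"

definition J10star :: "nat \<Rightarrow> rat" where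
  "J10star n = fls_nth j10star (int n)"

definition even_int :: "rat \<Rightarrow> bool" where
  "even_int x \<longleftrightarrow> (\<exists>m::int. x = of_int (2 * m))"

end

theory Submission
  imports Defs "HOL-Library.Z2"
begin

text \<open>
  Write \<open>f\<^sub>k\<close> for \<open>(q^k;q^k)\<^sub>\<infinity>\<close> and work modulo 2, where \<open>f\<^sub>2\<^sub>k = f\<^sub>k\<^sup>2\<close> and squares are series in
  \<open>q\<^sup>2\<close>. Part (b) is immediate, since \<open>q j\<^sub>1\<^sub>0\<^sup>*\<close> is congruent to a fourth power up to the constant term
  of \<open>j\<^sub>1\<^sub>0\<^sup>*\<close>. For part (a), \<open>F = q (j\<^sub>1\<^sub>0 + 1)\<close> is congruent to \<open>f\<^sub>1 / f\<^sub>5^5\<close>, and everything follows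
  from the congruence \<open>f\<^sub>1 f\<^sub>5 = f\<^sub>1^6 + q f\<^sub>5^6\<close>: it gives \<open>F = q + H\<^sup>2\<close> with
  \<open>H = (f\<^sub>1/f\<^sub>5)^3 = (f\<^sub>1\<^sup>2/f\<^sub>5)^4 + q (f\<^sub>1 f\<^sub>5)\<^sup>2\<close>.

  By the Jacobi triple product, that congruence is the reduction modulo 2 of an identity
  between products of two theta series, which compares the representations \<open>a\<^sup>2 + b\<^sup>2 = 8 N + 2\<close> by odd
  numbers with the representations of \<open>40 N + 10\<close>. Multiplication by the Gaussian integer \<open>2 - i\<close>
  matches them; the pairs for which the product is divisible by 5 account for the term with
  the factor \<open>q\<close>.
\<close>

unbundle fps_syntax

section \<open>Convergence of formal power series and Euler products\<close>

text \<open>Convergence means that each coefficient is eventually constant, and coefficient n of a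
  product involves only coefficients up to n of the factors.\<close>

lemma tendsto_mult_fps:
  fixes f g :: "'b \<Rightarrow> 'a::ring_1 fps"
  assumes "(f \<longlongrightarrow> a) F" "(g \<longlongrightarrow> b) F"
  shows "((\<lambda>x. f x * g x) \<longlongrightarrow> a * b) F"
  unfolding tendsto_fps_iff
proof
  fix n
  have "\<forall>\<^sub>F x in F. \<forall>i\<in>{..n}. f x $ i = a $ i" "\<forall>\<^sub>F x in F. \<forall>i\<in>{..n}. g x $ i = b $ i"
    using assms by (auto simp: tendsto_fps_iff eventually_ball_finite_distrib)
  then show "\<forall>\<^sub>F x in F. (f x * g x) $ n = (a * b) $ n"
    by eventually_elim (auto simp: fps_mult_nth intro!: sum.cong)
qed

text \<open>Only \<open>f\<close> is asked to converge, so \<open>g\<close> may be a family of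
  inverses of unknown limit.\<close>

lemma tendsto_mult_zero_fps:
  fixes f g :: "'b \<Rightarrow> 'a::ring_1 fps"
  assumes "(f \<longlongrightarrow> 0) F"
  shows "((\<lambda>x. f x * g x) \<longlongrightarrow> 0) F"
  unfolding tendsto_fps_iff
proof
  fix n
  have "\<forall>\<^sub>F x in F. \<forall>i\<in>{..n}. f x $ i = 0"
    using assms by (auto simp: tendsto_fps_iff eventually_ball_finite_distrib)
  then show "\<forall>\<^sub>F x in F. (f x * g x) $ n = (0::'a fps) $ n"
    by eventually_elim (auto simp: fps_mult_nth)
qed

lemma tendsto_minus_const_iff_fps:
  fixes f :: "'b \<Rightarrow> 'a::ring_1 fps"
  shows "((\<lambda>x. f x - a) \<longlongrightarrow> 0) F \<longleftrightarrow> (f \<longlongrightarrow> a) F"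
  by (simp add: tendsto_fps_iff)

lemma tendsto_power_fps:
  fixes f :: "'b \<Rightarrow> 'a::ring_1 fps"
  assumes "(f \<longlongrightarrow> a) F"
  shows "((\<lambda>x. f x ^ m) \<longlongrightarrow> a ^ m) F"
  by (induction m) (auto intro!: tendsto_mult_fps assms)

text \<open>The series \<open>qpoch\<close> over any commutative ring, to be read over the integers,
  the rationals and the field of two elements.\<close>

definition euler_prod :: "nat \<Rightarrow> 'a::comm_ring_1 fps" where
  "euler_prod k = Abs_fps (\<lambda>N. (\<Prod>j\<in>{1..N}. (1 - fps_X ^ (k * j))) $ N)"

lemma one_minus_X_power_mult_nth:
  fixes f :: "'a::comm_ring_1 fps"
  assumes "i < m"
  shows "(f * (1 - fps_X ^ m)) $ i = f $ i"
  using assms by (simp add: right_diff_distrib fps_X_power_mult_right_nth)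

text \<open>Factors with j > i do not touch coefficient i, because k j > i.\<close>

lemma euler_prod_partial_nth:
  assumes "k \<ge> 1" "N \<ge> i"
  shows "(\<Prod>j\<in>{1..N}. (1 - fps_X ^ (k * j))) $ i = (euler_prod k :: 'a::comm_ring_1 fps) $ i"
  using \<open>N \<ge> i\<close>
proof (induction N rule: dec_induct)
  case base
  then show ?case by (simp add: euler_prod_def)
next
  case (step N)
  have "i < k * Suc N"
    using assms(1) step(1) by (metis less_Suc_eq_le mult_le_mono1 mult_1 order_less_le_trans)
  then show ?case
    using step by (simp add: one_minus_X_power_mult_nth del: mult_Suc_right)
qed

lemma euler_prod_nth_0: "(euler_prod k :: 'a::comm_ring_1 fps) $ 0 = 1"
  by (simp add: euler_prod_def)

lemma tendsto_euler_prod: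
  assumes "k \<ge> 1" "filterlim g at_top F"
  shows "((\<lambda>x. \<Prod>j\<in>{1..g x}. (1 - fps_X ^ (k * j))) \<longlongrightarrow> (euler_prod k :: 'a::comm_ring_1 fps)) F"
  unfolding tendsto_fps_iff
proof
  fix n
  have "\<forall>\<^sub>F x in F. g x \<ge> n"
    using assms(2) by (simp add: filterlim_at_top)
  then show "\<forall>\<^sub>F x in F. (\<Prod>j\<in>{1..g x}. (1 - fps_X ^ (k * j))) $ n = (euler_prod k :: 'a fps) $ n"
    by eventually_elim (rule euler_prod_partial_nth[OF assms(1)])
qed

section \<open>The Jacobi triple product\<close>

text \<open>Gaussian binomial coefficients, given by a q-Pascal rule so that no division
  occurs.\<close>

fun qbinom :: "'a::comm_ring_1 \<Rightarrow> nat \<Rightarrow> nat \<Rightarrow> 'a" where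
  "qbinom Q _ 0 = 1"
| "qbinom Q 0 (Suc k) = 0"
| "qbinom Q (Suc n) (Suc k) = qbinom Q n k + Q ^ Suc k * qbinom Q n (Suc k)"

lemma qbinom_eq_0: "n < k \<Longrightarrow> qbinom Q n k = 0"
  by (induction Q n k rule: qbinom.induct) auto

lemma qbinom_same: "qbinom Q n n = 1"
  by (induction n) (auto simp: qbinom_eq_0)

lemma qbinom_factorial:
  "k \<le> n \<Longrightarrow> qbinom Q n k * ((\<Prod>j\<in>{1..k}. 1 - Q ^ j) * (\<Prod>j\<in>{1..n-k}. 1 - Q ^ j)) = (\<Prod>j\<in>{1..n}. 1 - Q ^ j)"
proof (induction Q n k rule: qbinom.induct)
  case (3 Q n k)
  show ?case
  proof (cases "k = n")
    case True
    then show ?thesis by (simp add: qbinom_same qbinom_eq_0)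
  next
    case False
    define P where "P m = (\<Prod>j\<in>{1..m}. 1 - Q ^ j)" for m
    have P_Suc: "P (Suc m) = P m * (1 - Q ^ Suc m)" for m by (simp add: P_def)
    have lt: "Suc k \<le> n" using False 3(3) by auto
    obtain d where n: "n = Suc k + d" using lt le_Suc_ex by blast
    then have d: "n - k = Suc d" "n - Suc k = d" by auto
    have IH: "qbinom Q n k * (P k * P (Suc d)) = P n" "qbinom Q n (Suc k) * (P (Suc k) * P d) = P n"
      using 3(1,2) lt unfolding d P_def by auto
    have "qbinom Q (Suc n) (Suc k) * (P (Suc k) * P (Suc n - Suc k))
          = (1 - Q ^ Suc k) * (qbinom Q n k * (P k * P (Suc d)))
            + Q ^ Suc k * (1 - Q ^ Suc d) * (qbinom Q n (Suc k) * (P (Suc k) * P d))"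
      by (simp only: qbinom.simps diff_Suc_Suc d(1) P_Suc) (simp only: algebra_simps)
    \<comment> \<open>This uses 1 - Q^(n+1) = (1 - Q^(k+1)) + Q^(k+1) (1 - Q^(d+1)), as n + 1 = (k +
      1) + (d + 1).\<close>
    also have "\<dots> = P n * (1 - Q ^ Suc n)"
      unfolding IH by (simp add: n algebra_simps power_add)
    finally show ?thesis by (simp only: P_Suc[symmetric]) (simp only: P_def)
  qed
qed auto

text \<open>The homogeneous form allows s = Q^N later, without negative powers. Splitting off the
  factor i = 0 turns t into t Q, hence the induction for arbitrary t.\<close>

lemma qbinomial_theorem:
  fixes s t :: "'a::comm_ring_1"
  shows "(\<Prod>i<n. s + t * Q ^ i) = (\<Sum>k\<le>n. qbinom Q n k * Q ^ (k choose 2) * t ^ k * s ^ (n - k))"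
proof (induction n arbitrary: t)
  case (Suc n)
  have c2: "Suc k choose 2 = k + (k choose 2)" for k
    by (simp add: numeral_2_eq_2)
  let ?T = "\<lambda>k. qbinom Q n k * Q ^ (k choose 2) * (t * Q) ^ k * s ^ (n - k)"
  have "(\<Prod>i<Suc n. s + t * Q ^ i) = (s + t * Q ^ 0) * (\<Prod>i<n. s + t * Q ^ Suc i)"
    by (rule prod.lessThan_Suc_shift)
  also have "\<dots> = (s + t) * (\<Prod>i<n. s + (t * Q) * Q ^ i)"
    by (simp add: mult_ac)
  also have "\<dots> = s * (\<Sum>k\<le>n. ?T k) + t * (\<Sum>k\<le>n. ?T k)"
    unfolding Suc.IH by (simp only: algebra_simps)
  also have "s * (\<Sum>k\<le>n. ?T k) = s * (s ^ n + (\<Sum>k<n. ?T (Suc k)))"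
    by (simp add: sum.atMost_shift binomial_eq_0)
  also have "(\<Sum>k<n. ?T (Suc k)) = (\<Sum>k\<le>n. qbinom Q n (Suc k) * Q ^ (Suc k choose 2) * (t * Q) ^ Suc k * s ^ (n - Suc k))"
    by (intro sum.mono_neutral_left) (auto simp: qbinom_eq_0)
  finally have "(\<Prod>i<Suc n. s + t * Q ^ i) = s ^ Suc n
     + (\<Sum>k\<le>n. s * (qbinom Q n (Suc k) * Q ^ (Suc k choose 2) * (t * Q) ^ Suc k * s ^ (n - Suc k)) + t * ?T k)"
    by (simp add: sum.distrib sum_distrib_left distrib_left)
  also have "(\<Sum>k\<le>n. s * (qbinom Q n (Suc k) * Q ^ (Suc k choose 2) * (t * Q) ^ Suc k * s ^ (n - Suc k)) + t * ?T k)
     = (\<Sum>k\<le>n. qbinom Q (Suc n) (Suc k) * Q ^ (Suc k choose 2) * t ^ Suc k * s ^ (Suc n - Suc k))"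
  proof (intro sum.cong refl)
    fix k assume "k \<in> {..n}"
    then consider "k = n" | d where "n = Suc k + d"
      by (metis atMost_iff le_eq_less_or_eq less_iff_Suc_add add_Suc)
    then show "s * (qbinom Q n (Suc k) * Q ^ (Suc k choose 2) * (t * Q) ^ Suc k * s ^ (n - Suc k)) + t * ?T k
      = qbinom Q (Suc n) (Suc k) * Q ^ (Suc k choose 2) * t ^ Suc k * s ^ (Suc n - Suc k)"
    proof cases
      case 1
      then show ?thesis
        by (simp add: qbinom_eq_0 c2 power_add power_mult_distrib)
    next
      case 2
      then have "n - k = Suc d" "n - Suc k = d" by auto
      then show ?thesis
        by (simp add: c2 power_add power_mult_distrib algebra_simps)
    qed
  qed
  also have "s ^ Suc n + \<dots> = (\<Sum>k\<le>Suc n. qbinom Q (Suc n) k * Q ^ (k choose 2) * t ^ k * s ^ (Suc n - k))"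
    by (subst sum.atMost_Suc_shift) (simp add: binomial_eq_0)
  finally show ?case .
qed (simp add: binomial_eq_0)

section \<open>Triangular exponents and the finite triple product\<close>

definition tri :: "int \<Rightarrow> nat" where
  "tri k = nat (k * (k + 1) div 2)"

lemma two_tri: "2 * int (tri k) = k * (k + 1)"
proof -
  have "k * (k + 1) \<ge> 0"
    by (cases "k \<ge> 0") (auto intro: mult_nonpos_nonpos)
  then show ?thesis
    by (simp add: tri_def)
qed

lemma two_choose_two: "2 * int (n choose 2) = int n * (int n - 1)"
proof (cases n)
  case (Suc m)
  have "2 * (n choose 2) = n * m"
    by (simp add: choose_two Suc)
  then have "int (2 * (n choose 2)) = int (n * m)" by (rule arg_cong)
  then show ?thesis by (simp add: Suc algebra_simps)
qed simp

lemma prod_lessThan_add: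
  fixes f :: "nat \<Rightarrow> 'a::comm_monoid_mult"
  shows "(\<Prod>i<m + n. f i) = (\<Prod>i<m. f i) * (\<Prod>i<n. f (m + i))"
  by (induction n) (auto simp: mult.assoc)

lemma prod_power_lessThan:
  fixes Q :: "'a::comm_monoid_mult"
  shows "(\<Prod>i<n. Q ^ i) = Q ^ (n choose 2)"
  by (induction n) (auto simp: numeral_2_eq_2 power_add mult.commute)

text \<open>The product of Q^N + x Q^i over i < 2 N, with Q = x y, is evaluated twice. Its lower
  half, reversed, yields the factors 1 + y Q^i and its upper half the factors 1 + x Q^i, up to the
  monomial \<open>K\<close>; the q-binomial theorem yields the sum, and \<open>K\<close>
  cancels.\<close>

lemma jacobi_triple_finite:
  fixes x y :: "'a::idom"
  assumes "x \<noteq> 0" "y \<noteq> 0"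
  shows "(\<Prod>j<N. (1 + x * (x * y) ^ j) * (1 + y * (x * y) ^ j)) =
         (\<Sum>i\<le>2*N. qbinom (x * y) (2 * N) i * (x ^ tri (int i - int N) * y ^ tri (int i - int N - 1)))"
    (is "?L = ?R")
proof -
  define Q where "Q = x * y"
  define K where "K = x ^ N * Q ^ (N choose 2) * Q ^ (N * N)"
  have "K \<noteq> 0" using assms by (simp add: K_def Q_def)
  have "(\<Prod>i<2*N. Q ^ N + x * Q ^ i) = (\<Prod>i<N. Q ^ N + x * Q ^ i) * (\<Prod>i<N. Q ^ N + x * Q ^ (N + i))"
    by (simp add: mult_2 prod_lessThan_add)
  also have "(\<Prod>i<N. Q ^ N + x * Q ^ i) = (\<Prod>i<N. Q ^ N + x * Q ^ (N - Suc i))"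
    by (rule prod.nat_diff_reindex[symmetric])
  also have "\<dots> = (\<Prod>i<N. x * Q ^ (N - Suc i) * (1 + y * Q ^ i))"
  proof (intro prod.cong refl)
    fix i assume "i \<in> {..<N}"
    then have "N = Suc (N - Suc i + i)" by auto
    then have "Q ^ N = Q * (Q ^ (N - Suc i) * Q ^ i)"
      by (metis power_Suc power_add)
    then show "Q ^ N + x * Q ^ (N - Suc i) = x * Q ^ (N - Suc i) * (1 + y * Q ^ i)"
      by (simp add: Q_def algebra_simps)
  qed
  also have "\<dots> = x ^ N * Q ^ (N choose 2) * (\<Prod>i<N. 1 + y * Q ^ i)"
    by (simp add: prod.distrib prod.nat_diff_reindex[of "\<lambda>i. Q ^ i"] prod_power_lessThan)
  also have "(\<Prod>i<N. Q ^ N + x * Q ^ (N + i)) = (\<Prod>i<N. Q ^ N * (1 + x * Q ^ i))"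
    by (simp add: power_add algebra_simps)
  also have "\<dots> = Q ^ (N * N) * (\<Prod>i<N. 1 + x * Q ^ i)"
    by (simp add: prod.distrib power_mult)
  finally have "(\<Prod>i<2*N. Q ^ N + x * Q ^ i) = K * ?L"
    by (simp add: K_def prod.distrib mult_ac flip: Q_def)
  also have "(\<Prod>i<2*N. Q ^ N + x * Q ^ i) = K * ?R"
    unfolding qbinomial_theorem sum_distrib_left Q_def[symmetric]
  proof (intro sum.cong refl)
    fix i assume "i \<in> {..2*N}"
    then have i: "i \<le> 2 * N" by simp
    let ?k = "int i - int N"
    have e: "int (N * (2 * N - i)) = int N * (2 * int N - int i)"
      using i by (simp add: of_nat_diff)
    \<comment> \<open>These two equations compare the exponents of y and of x, in this
      order.\<close>
    have 1: "(i choose 2) + N * (2 * N - i) = (N choose 2) + N * N + tri (?k - 1)"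
      using two_choose_two[of i] two_choose_two[of N] two_tri[of "?k - 1"]
      by (subst int_int_eq[symmetric], unfold of_nat_add e) (simp add: algebra_simps)
    have 2: "i + ((i choose 2) + N * (2 * N - i)) = N + ((N choose 2) + N * N) + tri ?k"
      using two_choose_two[of i] two_choose_two[of N] two_tri[of "?k"]
      by (subst int_int_eq[symmetric], unfold of_nat_add e) (simp add: algebra_simps)
    have "Q ^ (i choose 2) * x ^ i * (Q ^ N) ^ (2 * N - i)
          = x ^ (i + ((i choose 2) + N * (2 * N - i))) * y ^ ((i choose 2) + N * (2 * N - i))"
      by (simp add: Q_def power_mult_distrib power_add mult_ac flip: power_mult)
    also have "\<dots> = K * (x ^ tri ?k * y ^ tri (?k - 1))"
      unfolding 2 unfolding 1 by (simp add: K_def Q_def power_mult_distrib power_add mult_ac)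
    finally show "qbinom Q (2 * N) i * Q ^ (i choose 2) * x ^ i * (Q ^ N) ^ (2 * N - i)
        = K * (qbinom Q (2 * N) i * (x ^ tri ?k * y ^ tri (?k - 1)))"
      by (simp add: mult_ac)
  qed
  finally show ?thesis
    using \<open>K \<noteq> 0\<close> by simp
qed

text \<open>Ramanujan's f(q^b, q^c), the sum of q^(b k(k+1)/2 + c k(k-1)/2) over all integers k. For
  b, c \<ge> 1 the fibres are finite, so \<open>card\<close> gives the true coefficients.\<close>

definition theta :: "nat \<Rightarrow> nat \<Rightarrow> 'a::comm_ring_1 fps" where
  "theta b c = Abs_fps (\<lambda>n. of_nat (card {k. b * tri k + c * tri (k - 1) = n}))"

text \<open>The two triangular numbers add up to the square of k.\<close>

lemma abs_le_theta_exponent: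
  assumes "b \<ge> 1" "c \<ge> 1"
  shows "nat \<bar>k\<bar> \<le> b * tri k + c * tri (k - 1)"
proof -
  have "int (tri k + tri (k - 1)) = k * k"
    using two_tri[of k] two_tri[of "k - 1"] by (simp add: algebra_simps)
  moreover have "\<bar>k\<bar> \<le> k * k"
    using mult_left_mono[of 1 "\<bar>k\<bar>" "\<bar>k\<bar>"] by (cases "k = 0") (auto simp: abs_mult_self_eq)
  ultimately have "\<bar>k\<bar> \<le> int (tri k + tri (k - 1))" by simp
  then have "nat \<bar>k\<bar> \<le> tri k + tri (k - 1)" by (simp only: nat_le_iff)
  also have "\<dots> \<le> b * tri k + c * tri (k - 1)"
    using assms by (intro add_mono) auto
  finally show ?thesis .
qed

lemma finite_theta_fibre:
  assumes "b \<ge> 1" "c \<ge> 1"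
  shows "finite {k. b * tri k + c * tri (k - 1) = n}"
proof (rule finite_subset)
  have "k \<in> {- int n..int n}" if "b * tri k + c * tri (k - 1) = n" for k
    using abs_le_theta_exponent[OF assms, of k] unfolding that by auto
  then show "{k. b * tri k + c * tri (k - 1) = n} \<subseteq> {- int n..int n}"
    by blast
qed simp

text \<open>The coefficient is P(2N) / (P(N+k) P(N-k)) for the partial products P, and all three
  tend to the Euler product E, so it tends to 1/E.\<close>

lemma tendsto_qbinom_euler_prod:
  fixes e :: nat and k :: int
  assumes "e \<ge> 1"
  shows "(\<lambda>N. euler_prod e * qbinom (fps_X ^ e) (2 * N) (nat (int N + k))) \<longlonglongrightarrow> (1 :: 'a::field fps)"
proof -
  define P :: "nat \<Rightarrow> 'a fps" where "P m = (\<Prod>j\<in>{1..m}. 1 - fps_X ^ (e * j))" for m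
  define E :: "'a fps" where "E = euler_prod e"
  define D where "D N = P (nat (int N + k)) * P (nat (int N - k))" for N
  have lim: "((\<lambda>x. P (g x)) \<longlongrightarrow> E) F" if "filterlim g at_top F" for g and F :: "nat filter"
    unfolding P_def E_def by (rule tendsto_euler_prod[OF assms that])
  have f: "filterlim (\<lambda>N. nat (int N + k)) at_top sequentially" for k
    unfolding filterlim_at_top
  proof
    fix Z
    show "\<forall>\<^sub>F N in sequentially. Z \<le> nat (int N + k)"
      by (rule eventually_sequentiallyI[of "Z + nat \<bar>k\<bar>"]) auto
  qed
  have f2: "filterlim (\<lambda>N::nat. 2 * N) at_top sequentially"
    by (rule filterlim_at_top_mono[OF filterlim_ident]) simp
  have D: "D \<longlonglongrightarrow> E * E"
    unfolding D_def using f[of k] f[of "-k"] by (intro tendsto_mult_fps lim) auto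
  have P0: "P m $ 0 = 1" for m
    using assms by (induction m) (auto simp: P_def)
  let ?b = "\<lambda>N. qbinom (fps_X ^ e) (2 * N) (nat (int N + k)) :: 'a fps"
  have "(\<lambda>N. E * P (2 * N) - D N) \<longlonglongrightarrow> 0"
    unfolding tendsto_fps_iff
  proof
    fix n
    have "\<forall>\<^sub>F N in sequentially. (E * P (2 * N)) $ n = (E * E) $ n"
      using tendsto_mult_fps[OF tendsto_const lim[OF f2], of E] unfolding tendsto_fps_iff by blast
    moreover have "\<forall>\<^sub>F N in sequentially. D N $ n = (E * E) $ n"
      using D unfolding tendsto_fps_iff by blast
    ultimately show "\<forall>\<^sub>F N in sequentially. (E * P (2 * N) - D N) $ n = (0 :: 'a fps) $ n"
      by eventually_elim simp
  qed
  then have "(\<lambda>N. (E * P (2 * N) - D N) * inverse (D N)) \<longlonglongrightarrow> 0"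
    by (rule tendsto_mult_zero_fps)
  moreover have "\<forall>\<^sub>F N in sequentially. (E * P (2 * N) - D N) * inverse (D N) = E * ?b N - 1"
  \<comment> \<open>From N = |k| on, neither N + k nor N - k is cut off by
    \<open>nat\<close>.\<close>
  proof (rule eventually_sequentiallyI[of "nat \<bar>k\<bar>"])
    fix N assume N: "nat \<bar>k\<bar> \<le> N"
    have *: "nat (int N + k) \<le> 2 * N" "2 * N - nat (int N + k) = nat (int N - k)"
      using N by auto
    have "P (2 * N) = ?b N * D N"
      using qbinom_factorial[OF *(1), of "fps_X ^ e :: 'a fps"]
      unfolding D_def P_def *(2) by (simp add: power_mult)
    then have "(E * P (2 * N) - D N) * inverse (D N) = (E * ?b N - 1) * (D N * inverse (D N))"
      by (simp add: algebra_simps)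
    also have "D N * inverse (D N) = 1"
      by (rule inverse_mult_eq_1') (simp add: D_def P0)
    finally show "(E * P (2 * N) - D N) * inverse (D N) = E * ?b N - 1"
      by simp
  qed
  ultimately have "(\<lambda>N. E * ?b N - 1) \<longlonglongrightarrow> 0"
    by (rule Lim_transform_eventually)
  then show ?thesis
    unfolding E_def tendsto_minus_const_iff_fps .
qed

text \<open>The finite identity is taken at x = q^b, y = q^c. Since the exponent of term k is at
  least |k|, only |k| \<le> n matters for coefficient n, and for these finitely many k the factors
  \<open>B N k\<close> eventually agree with 1 up to degree n.\<close>

theorem jacobi_triple_fps:
  assumes "b \<ge> 1" "c \<ge> 1"
  shows "(\<lambda>N. euler_prod (b + c) * (\<Prod>j<N. (1 + fps_X ^ (b + (b + c) * j)) * (1 + fps_X ^ (c + (b + c) * j))))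
           \<longlonglongrightarrow> (theta b c :: 'a::field fps)"
  unfolding tendsto_fps_iff
proof
  fix n
  define ex where "ex k = b * tri k + c * tri (k - 1)" for k
  define A where "A = {k. ex k = n}"
  define B where "B N k = (euler_prod (b + c) * qbinom (fps_X ^ (b + c)) (2 * N) (nat (int N + k)) :: 'a fps)" for N k
  let ?L = "\<lambda>N. euler_prod (b + c) * (\<Prod>j<N. (1 + fps_X ^ (b + (b + c) * j)) * (1 + fps_X ^ (c + (b + c) * j))) :: 'a fps"
  have ex: "\<bar>k\<bar> \<le> int (ex k)" for k
    using abs_le_theta_exponent[OF assms, of k] unfolding ex_def[symmetric] by linarith
  have L: "?L N = (\<Sum>k\<in>{- int N..int N}. B N k * fps_X ^ ex k)" for N
  proof -
    have "(\<Prod>j<N. (1 + fps_X ^ (b + (b + c) * j)) * (1 + fps_X ^ (c + (b + c) * j)))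
       = (\<Sum>i\<le>2*N. qbinom (fps_X ^ (b + c)) (2 * N) i * (fps_X ^ ex (int i - int N)) :: 'a fps)"
      using jacobi_triple_finite[of "fps_X ^ b" "fps_X ^ c :: 'a fps" N]
      by (simp add: ex_def power_add power_mult)
    also have "\<dots> = (\<Sum>k\<in>{- int N..int N}. qbinom (fps_X ^ (b + c)) (2 * N) (nat (int N + k)) * fps_X ^ ex k)"
      by (rule sum.reindex_bij_witness[of _ "\<lambda>k. nat (int N + k)" "\<lambda>i. int i - int N"]) auto
    finally show ?thesis
      by (simp add: B_def sum_distrib_left mult.assoc)
  qed
  have "\<forall>\<^sub>F N in sequentially. \<forall>k\<in>{- int n..int n}. \<forall>m\<in>{..n}. B N k $ m = (1 :: 'a fps) $ m"
    using tendsto_qbinom_euler_prod[of "b + c", where ?'a = 'a] assms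
    unfolding B_def tendsto_fps_iff by (auto simp: eventually_ball_finite_distrib simp del: fps_one_nth)
  moreover have "\<forall>\<^sub>F N in sequentially. n \<le> N"
    by (rule eventually_ge_at_top)
  ultimately show "\<forall>\<^sub>F N in sequentially. ?L N $ n = (theta b c :: 'a fps) $ n"
  proof eventually_elim
    case (elim N)
    have "?L N $ n = (\<Sum>k\<in>{- int N..int N}. (B N k * fps_X ^ ex k) $ n)"
      unfolding L by (simp add: fps_sum_nth)
    also have "\<dots> = (\<Sum>k\<in>{- int N..int N}. if k \<in> A then 1 else 0)"
    proof (intro sum.cong refl)
      fix k assume "k \<in> {- int N..int N}"
      show "(B N k * fps_X ^ ex k) $ n = (if k \<in> A then 1 else 0)"
      proof (cases "ex k \<le> n")
        case True
        then have "k \<in> {- int n..int n}" using ex[of k] by auto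
        then have "B N k $ (n - ex k) = (1 :: 'a fps) $ (n - ex k)"
          using elim(1) by auto
        then show ?thesis
          using True by (auto simp: fps_X_power_mult_right_nth A_def)
      qed (auto simp: fps_X_power_mult_right_nth A_def)
    qed
    also have "\<dots> = of_nat (card ({- int N..int N} \<inter> A))"
      by (simp add: sum.If_cases)
    also have "{- int N..int N} \<inter> A = A"
    proof -
      have "k \<in> {- int N..int N}" if "k \<in> A" for k
        using ex[of k] that elim(2) unfolding A_def by auto
      then show ?thesis by blast
    qed
    finally show ?case by (simp add: theta_def A_def ex_def)
  qed
qed

section \<open>An identity between theta series\<close>

text \<open>
  With \<open>a = 1 - 4 j\<close>, \<open>b = 1 - 4 k\<close>, \<open>u = 10 m - 3\<close>, \<open>v = 10 n - 1\<close> the sets below are given by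
  \<open>a\<^sup>2 + b\<^sup>2 = 8 N + 2\<close> and \<open>u\<^sup>2 + v\<^sup>2 = 40 N + 10\<close>; \<open>V\<close> collects the pairs for which
  \<open>a + b i\<close> is a multiple of \<open>2 + i\<close>. The four cases of \<open>g\<close> select the associate or conjugate
  that satisfies the congruences modulo 4.
\<close>

lemma card_odd_two_squares:
  fixes N :: int
  defines "S \<equiv> {(j, k). 2 * j\<^sup>2 - j + (2 * k\<^sup>2 - k) = N}"
    and "T \<equiv> {(m, n). 5 * m\<^sup>2 - 3 * m + (5 * n\<^sup>2 - n) = 2 * N}"
    and "V \<equiv> {(c, d). 5 * (2 * c\<^sup>2 - c) + 5 * (2 * d\<^sup>2 - d) + 1 = N}"
  assumes "finite S"
  shows "card S = card T + card V"
proof -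
  \<comment> \<open>For a = 1 - 4 j and b = 1 - 4 k this says that 2 + i divides a + b i: modulo 5,
    2 a + b is 3 - 4 (2 j + k).\<close>
  define R where "R = {(j, k). (2 * j + k) mod 5 = (2::int)}"
  have div5: "x div 5 = y" if "x = 5 * y" for x y :: int
    using that by simp
  have R_E: thesis if "(j, k) \<in> R" "\<And>t. k = 5 * t + 2 - 2 * j \<Longrightarrow> thesis" for j k thesis
    using that(1) by (intro that(2)[of "(2 * j + k) div 5"]) (simp add: R_def, presburger)
  \<comment> \<open>In the coordinates a, b this multiplies -(1 - 4 c) + (1 - 4 d) i by 2 + i;
    \<open>f'\<close> undoes it on \<open>R\<close>.\<close>
  define f where "f = (\<lambda>(c, d). (1 - 2 * c - d, 2 * d - c :: int))"
  define f' where "f' = (\<lambda>(j, k). ((2 - 2 * j - k) div 5, (1 - j + 2 * k) div 5 :: int))"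
  have f': "f' (j, 5 * t + 2 - 2 * j) = (- t, 1 - j + 2 * t)" for j t
  proof -
    have "(2 - 2 * j - (5 * t + 2 - 2 * j)) div 5 = - t" "(1 - j + 2 * (5 * t + 2 - 2 * j)) div 5 = 1 - j + 2 * t"
      by (intro div5; simp)+
    then show ?thesis by (simp add: f'_def)
  qed
  have "bij_betw f V (S \<inter> R)"
  proof (rule bij_betw_byWitness[where f' = f'])
    show "\<forall>p\<in>V. f' (f p) = p"
    proof
      fix p assume "p \<in> V"
      obtain c d where p: "p = (c, d)" by (cases p)
      have "f p = (1 - 2 * c - d, 5 * (- c) + 2 - 2 * (1 - 2 * c - d))"
        by (simp add: p f_def)
      then show "f' (f p) = p" by (simp only: f') (simp add: p)
    qed
    show "\<forall>p\<in>S \<inter> R. f (f' p) = p"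
    proof
      fix p assume "p \<in> S \<inter> R"
      then obtain j k where p: "p = (j, k)" "(j, k) \<in> R" by (cases p) auto
      obtain t where "k = 5 * t + 2 - 2 * j" using p(2) by (rule R_E)
      then show "f (f' p) = p" unfolding p by (simp only: f') (simp add: f_def)
    qed
    show "f ` V \<subseteq> S \<inter> R"
    proof
      fix q assume "q \<in> f ` V"
      then obtain c d where q: "q = (1 - 2 * c - d, 2 * d - c)" and V: "(c, d) \<in> V"
        by (auto simp: f_def)
      have "2 * (1 - 2 * c - d) + (2 * d - c) = 5 * (- c) + 2" by simp
      then have "(2 * (1 - 2 * c - d) + (2 * d - c)) mod 5 = 2" by presburger
      then show "q \<in> S \<inter> R"
        using V unfolding q V_def S_def R_def by (simp add: power2_eq_square algebra_simps)
    qed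
    show "f' ` (S \<inter> R) \<subseteq> V"
    proof
      fix q assume "q \<in> f' ` (S \<inter> R)"
      then obtain j k where q: "q = f' (j, k)" and S: "(j, k) \<in> S" and R: "(j, k) \<in> R" by auto
      obtain t where k: "k = 5 * t + 2 - 2 * j" using R by (rule R_E)
      have "q = (- t, 1 - j + 2 * t)" unfolding q k by (rule f')
      then show "q \<in> V"
        using S unfolding V_def S_def k by (simp add: power2_eq_square algebra_simps)
    qed
  qed
  then have V: "card V = card (S \<inter> R)" by (rule bij_betw_same_card)
  \<comment> \<open>The quotient of an associate of u + v i by 2 - i: the unit is -1 for m, n both
    even, i for only n odd, -i for only m odd, and 1 for both odd.\<close>
  define g :: "int \<times> int \<Rightarrow> int \<times> int" where
    "g = (\<lambda>(m, n). if even m then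
                      if even n then (m - n div 2, m div 2 + n) else (n + m div 2, (n + 1) div 2 - m)
                    else
                      if even n then (- n + (1 - m) div 2, m - n div 2) else (- m + (n + 1) div 2, (1 - m) div 2 - n))"
  \<comment> \<open>The inverse multiplies a + b i by 2 - i; the residue \<open>r\<close> tells
    which associate has u congruent to -3 and v to -1 modulo 10.\<close>
  define h :: "int \<times> int \<Rightarrow> int \<times> int" where
    "h = (\<lambda>(j, k). let r = (2 * j + k) mod 5 in
            if r = 0 then ((4 * j + 2 * k) div 5, (4 * k - 2 * j) div 5)
            else if r = 1 then ((1 - 2 * j + 4 * k) div 5, (2 - 4 * j - 2 * k) div 5)
            else if r = 3 then ((2 * j - 4 * k + 2) div 5, (4 * j + 2 * k - 1) div 5)
            else ((3 - 4 * j - 2 * k) div 5, (1 + 2 * j - 4 * k) div 5))"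
  \<comment> \<open>Writing the second component as 5 t + r - 2 j exhibits the residue of 2 j +
    k.\<close>
  have g: "g (2 * p, 2 * q) = (2 * p - q, 5 * p - 2 * (2 * p - q))"
    "g (2 * p, 2 * q + 1) = (2 * q + 1 + p, 5 * q + 3 - 2 * (2 * q + 1 + p))"
    "g (2 * p + 1, 2 * q) = (- 2 * q - p, 5 * (- q) + 1 - 2 * (- 2 * q - p))"
    "g (2 * p + 1, 2 * q + 1) = (- 2 * p + q, 5 * (- p - 1) + 4 - 2 * (- 2 * p + q))" for p q
    by (simp_all add: g_def)
  have parity_cases: "\<exists>p q. x = (2 * p, 2 * q) \<or> x = (2 * p, 2 * q + 1) \<or> x = (2 * p + 1, 2 * q) \<or> x = (2 * p + 1, 2 * q + 1)"
    for x :: "int \<times> int"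
  proof -
    obtain p q where "fst x = 2 * p \<or> fst x = 2 * p + 1" "snd x = 2 * q \<or> snd x = 2 * q + 1"
      by (metis evenE oddE)
    then show ?thesis by (metis prod.collapse)
  qed
  have h: "h (j, 5 * t - 2 * j) = (2 * t, 4 * t - 2 * j)"
    "h (j, 5 * t + 1 - 2 * j) = (1 - 2 * j + 4 * t, - 2 * t)"
    "h (j, 5 * t + 3 - 2 * j) = (2 * j - 4 * t - 2, 2 * t + 1)"
    "h (j, 5 * t + 4 - 2 * j) = (- 1 - 2 * t, 2 * j - 4 * t - 3)" for j t
  proof -
    have r: "(2 * j + (5 * t - 2 * j)) mod 5 = 0" "(2 * j + (5 * t + 1 - 2 * j)) mod 5 = 1"
      "(2 * j + (5 * t + 3 - 2 * j)) mod 5 = 3" "(2 * j + (5 * t + 4 - 2 * j)) mod 5 = 4"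
      by simp_all
    have d: "(4 * j + 2 * (5 * t - 2 * j)) div 5 = 2 * t"
      "(4 * (5 * t - 2 * j) - 2 * j) div 5 = 4 * t - 2 * j"
      "(1 - 2 * j + 4 * (5 * t + 1 - 2 * j)) div 5 = 1 - 2 * j + 4 * t"
      "(2 - 4 * j - 2 * (5 * t + 1 - 2 * j)) div 5 = - 2 * t"
      "(2 * j - 4 * (5 * t + 3 - 2 * j) + 2) div 5 = 2 * j - 4 * t - 2"
      "(4 * j + 2 * (5 * t + 3 - 2 * j) - 1) div 5 = 2 * t + 1"
      "(3 - 4 * j - 2 * (5 * t + 4 - 2 * j)) div 5 = - 1 - 2 * t"
      "(1 + 2 * j - 4 * (5 * t + 4 - 2 * j)) div 5 = 2 * j - 4 * t - 3"
      by (intro div5; simp)+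
    show "h (j, 5 * t - 2 * j) = (2 * t, 4 * t - 2 * j)"
      "h (j, 5 * t + 1 - 2 * j) = (1 - 2 * j + 4 * t, - 2 * t)"
      "h (j, 5 * t + 3 - 2 * j) = (2 * j - 4 * t - 2, 2 * t + 1)"
      "h (j, 5 * t + 4 - 2 * j) = (- 1 - 2 * t, 2 * j - 4 * t - 3)"
      unfolding h_def Let_def prod.case r d by simp_all
  qed
  have R_cases: "\<exists>t. k = 5 * t - 2 * j \<or> k = 5 * t + 1 - 2 * j \<or> k = 5 * t + 3 - 2 * j \<or> k = 5 * t + 4 - 2 * j"
    if "(j, k) \<notin> R" for j k
    using that by (intro exI[of _ "(2 * j + k) div 5"]) (simp add: R_def, presburger)
  have not_R: "(j, 5 * t - 2 * j) \<notin> R" "(j, 5 * t + 1 - 2 * j) \<notin> R" "(j, 5 * t + 3 - 2 * j) \<notin> R"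
    "(j, 5 * t + 4 - 2 * j) \<notin> R" for j t
    by (simp_all add: R_def)
  have "bij_betw g T (S - R)"
  proof (rule bij_betw_byWitness[where f' = h])
    show "\<forall>x\<in>T. h (g x) = x"
    proof
      fix x
      show "h (g x) = x"
        using parity_cases[of x] by (elim exE disjE) (simp_all only: g h, simp_all)
    qed
    show "\<forall>x\<in>S - R. g (h x) = x"
    proof
      fix x assume "x \<in> S - R"
      then obtain j k where x: "x = (j, k)" "(j, k) \<notin> R" by (cases x) auto
      have h': "h (j, 5 * t - 2 * j) = (2 * t, 2 * (2 * t - j))"
        "h (j, 5 * t + 1 - 2 * j) = (2 * (2 * t - j) + 1, 2 * (- t))"
        "h (j, 5 * t + 3 - 2 * j) = (2 * (j - 2 * t - 1), 2 * t + 1)"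
        "h (j, 5 * t + 4 - 2 * j) = (2 * (- t - 1) + 1, 2 * (j - 2 * t - 2) + 1)" for t
        by (simp_all add: h)
      show "g (h x) = x"
        using R_cases[OF x(2)] unfolding x(1) by (elim exE disjE) (simp_all only: h' g, simp_all)
    qed
    show "g ` T \<subseteq> S - R"
    proof
      fix y assume "y \<in> g ` T"
      then obtain x where y: "y = g x" and T: "x \<in> T" by auto
      have "y \<in> S"
        using parity_cases[of x] T unfolding y
        by (elim exE disjE) (simp_all only: g T_def S_def mem_Collect_eq prod.case, simp_all add: power2_eq_square algebra_simps)
      moreover have "y \<notin> R"
        using parity_cases[of x] unfolding y by (elim exE disjE) (simp_all only: g not_R not_False_eq_True)
      ultimately show "y \<in> S - R" by blast
    qed
    show "h ` (S - R) \<subseteq> T"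
    proof
      fix y assume "y \<in> h ` (S - R)"
      then obtain j k where y: "y = h (j, k)" and S: "(j, k) \<in> S" "(j, k) \<notin> R" by auto
      show "y \<in> T"
        using R_cases[OF S(2)] S(1) unfolding y
        by (elim exE disjE) (simp_all only: h T_def S_def mem_Collect_eq prod.case, simp_all add: power2_eq_square algebra_simps)
    qed
  qed
  then have T: "card T = card (S - R)" by (rule bij_betw_same_card)
  show ?thesis
    unfolding V T using card_Int_Diff[OF \<open>finite S\<close>, of R] by simp
qed

section \<open>Products of theta series as counts of pairs\<close>

lemma theta_pairs_eq_UN:
  fixes n :: nat
  shows "{(j, k). u j + v k = n} = (\<Union>i\<in>{0..n}. {j. u j = i} \<times> {k. v k = n - i})" (is "?L = ?R")
  by auto

lemma finite_theta_pairs: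
  assumes "a \<ge> 1" "b \<ge> 1" "c \<ge> 1" "d \<ge> 1"
  shows "finite {(j, k). (a * tri j + b * tri (j - 1)) + (c * tri k + d * tri (k - 1)) = n}"
  unfolding theta_pairs_eq_UN using assms by (auto intro!: finite_theta_fibre)

lemma theta_mult_nth:
  assumes "a \<ge> 1" "b \<ge> 1" "c \<ge> 1" "d \<ge> 1"
  shows "(theta a b * theta c d :: 'a::comm_ring_1 fps) $ n =
           of_nat (card {(j, k). (a * tri j + b * tri (j - 1)) + (c * tri k + d * tri (k - 1)) = n})"
proof -
  let ?u = "\<lambda>j. a * tri j + b * tri (j - 1)" and ?v = "\<lambda>k. c * tri k + d * tri (k - 1)"
  have "card {(j, k). ?u j + ?v k = n} = (\<Sum>i=0..n. card ({j. ?u j = i} \<times> {k. ?v k = n - i}))"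
    unfolding theta_pairs_eq_UN using assms
    by (intro card_UN_disjoint) (auto intro!: finite_theta_fibre)
  then show ?thesis
    by (simp add: fps_mult_nth theta_def card_cartesian_product)
qed

text \<open>The exponents of the theta series, turned into the quadratic forms of
  \<open>card_odd_two_squares\<close>. The last one uses \<open>Suc n\<close> because that product
  is later multiplied by q.\<close>

lemma int_theta_pairs:
  "{(j, k). (1 * tri j + 3 * tri (j - 1)) + (1 * tri k + 3 * tri (k - 1)) = n}
     = {(j, k). 2 * j\<^sup>2 - j + (2 * k\<^sup>2 - k) = int n}"
  "{(m, l). (1 * tri m + 4 * tri (m - 1)) + (2 * tri l + 3 * tri (l - 1)) = n}
     = {(m, l). 5 * m\<^sup>2 - 3 * m + (5 * l\<^sup>2 - l) = 2 * int n}"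
  "{(c, d). (5 * tri c + 15 * tri (c - 1)) + (5 * tri d + 15 * tri (d - 1)) = n}
     = {(c, d). 5 * (2 * c\<^sup>2 - c) + 5 * (2 * d\<^sup>2 - d) + 1 = int (Suc n)}"
proof -
  have A: "(x::nat) = y \<longleftrightarrow> 2 * int x = 2 * int y" for x y by auto
  have t: "2 * int (tri k) = k\<^sup>2 + k" "2 * int (tri (k - 1)) = k\<^sup>2 - k" for k
    using two_tri[of k] two_tri[of "k - 1"] by (simp_all add: power2_eq_square algebra_simps)
  show "{(j, k). (1 * tri j + 3 * tri (j - 1)) + (1 * tri k + 3 * tri (k - 1)) = n}
     = {(j, k). 2 * j\<^sup>2 - j + (2 * k\<^sup>2 - k) = int n}"
  proof (intro Collect_cong, clarify)
    fix j k
    show "(1 * tri j + 3 * tri (j - 1)) + (1 * tri k + 3 * tri (k - 1)) = n \<longleftrightarrow> 2 * j\<^sup>2 - j + (2 * k\<^sup>2 - k) = int n"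
      using t[of j] t[of k] unfolding A by auto
  qed
  show "{(m, l). (1 * tri m + 4 * tri (m - 1)) + (2 * tri l + 3 * tri (l - 1)) = n}
     = {(m, l). 5 * m\<^sup>2 - 3 * m + (5 * l\<^sup>2 - l) = 2 * int n}"
  proof (intro Collect_cong, clarify)
    fix m l
    show "(1 * tri m + 4 * tri (m - 1)) + (2 * tri l + 3 * tri (l - 1)) = n \<longleftrightarrow> 5 * m\<^sup>2 - 3 * m + (5 * l\<^sup>2 - l) = 2 * int n"
      using t[of m] t[of l] unfolding A by auto
  qed
  show "{(c, d). (5 * tri c + 15 * tri (c - 1)) + (5 * tri d + 15 * tri (d - 1)) = n}
     = {(c, d). 5 * (2 * c\<^sup>2 - c) + 5 * (2 * d\<^sup>2 - d) + 1 = int (Suc n)}"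
  proof (intro Collect_cong, clarify)
    fix c d
    show "(5 * tri c + 15 * tri (c - 1)) + (5 * tri d + 15 * tri (d - 1)) = n
      \<longleftrightarrow> 5 * (2 * c\<^sup>2 - c) + 5 * (2 * d\<^sup>2 - d) + 1 = int (Suc n)"
      using t[of c] t[of d] unfolding A by auto
  qed
qed

text \<open>In Ramanujan's notation: psi(q)^2 = f(q, q^4) f(q^2, q^3) + q psi(q^5)^2. Comparing
  coefficients gives \<open>card_odd_two_squares\<close>.\<close>

lemma theta_quintic_identity:
  "(theta 1 3 :: 'a::comm_ring_1 fps)\<^sup>2 = theta 1 4 * theta 2 3 + fps_X * (theta 5 15)\<^sup>2" (is "_ = _ + _ * ?V")
proof (rule fps_ext)
  fix n
  let ?Vn = "{(c, d). 5 * (2 * c\<^sup>2 - c) + 5 * (2 * d\<^sup>2 - d) + 1 = int n}"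
  have V: "(fps_X * ?V) $ n = of_nat (card ?Vn)"
  proof (cases n)
    case 0
    \<comment> \<open>The left side is 1 modulo 5, so coefficient 0 counts an empty set.\<close>
    have "5 * (2 * c\<^sup>2 - c) + 5 * (2 * d\<^sup>2 - d) + 1 \<noteq> 0" for c d :: int
      by presburger
    then show ?thesis using 0 by simp
  next
    case (Suc m)
    then show ?thesis
      using theta_mult_nth[of 5 15 5 15 m, where ?'a = 'a]
      unfolding int_theta_pairs by (simp add: power2_eq_square)
  qed
  have "(theta 1 3 * theta 1 3 :: 'a fps) $ n = (theta 1 4 * theta 2 3) $ n + of_nat (card ?Vn)"
    using theta_mult_nth[of 1 3 1 3 n, where ?'a = 'a] theta_mult_nth[of 1 4 2 3 n, where ?'a = 'a]
      card_odd_two_squares[of "int n"] finite_theta_pairs[of 1 3 1 3 n]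
    unfolding int_theta_pairs by simp
  then show "((theta 1 3)\<^sup>2 :: 'a fps) $ n = (theta 1 4 * theta 2 3 + fps_X * ?V) $ n"
    unfolding fps_add_nth V by (simp only: power2_eq_square[of "theta 1 3"])
qed

section \<open>Euler products modulo 2\<close>

lemma bit_fps_two [simp]: "(2 :: bit fps) = 0"
  by (simp add: fps_eq_iff numeral_fps_const)

lemma bit_fps_diff: "f - g = (f + g :: bit fps)"
  by (simp add: fps_eq_iff)

lemma bit_fps_add_self [simp]: "f + f = (0 :: bit fps)"
  by (simp add: fps_eq_iff)

lemma bit_fps_square_add: "(f + g :: bit fps)\<^sup>2 = f\<^sup>2 + g\<^sup>2"
  by (simp add: power2_sum)

text \<open>Frobenius: f(q)^2 = f(q^2). The induction splits off the constant term.\<close>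

lemma bit_fps_square_nth: "(f\<^sup>2 :: bit fps) $ n = (if even n then f $ (n div 2) else 0)"
proof (induction n arbitrary: f rule: less_induct)
  case (less n)
  define g where "g = fps_shift 1 f"
  have f: "f = fps_const (f $ 0) + fps_X * g"
    by (auto simp: fps_eq_iff g_def)
  have "f\<^sup>2 = fps_const (f $ 0) + fps_X ^ 2 * g\<^sup>2"
    by (subst f, subst bit_fps_square_add) (cases "f $ 0"; simp add: power_mult_distrib)
  then have "(f\<^sup>2) $ n = (fps_const (f $ 0)) $ n + (if n < 2 then 0 else (g\<^sup>2) $ (n - 2))"
    by (simp add: fps_X_power_mult_nth)
  also have "\<dots> = (if even n then f $ (n div 2) else 0)"
  proof (cases "n < 2")
    case True
    then have "n = 0 \<or> n = 1" by auto
    then show ?thesis by auto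
  next
    case False
    then obtain m where n: "n = Suc (Suc m)"
      by (metis add_2_eq_Suc le_Suc_ex not_less)
    then show ?thesis using less[of m g] by (auto simp: g_def)
  qed
  finally show ?case .
qed

lemma bit_fps_power4_nth: "(f ^ 4 :: bit fps) $ n = (if 4 dvd n then f $ (n div 4) else 0)"
proof -
  have d: "4 dvd n \<longleftrightarrow> even n \<and> even (n div 2)" by presburger
  have "(f ^ 4) $ n = ((f\<^sup>2)\<^sup>2) $ n" by (simp flip: power_mult)
  also have "\<dots> = (if even n then (f\<^sup>2) $ (n div 2) else 0)"
    by (rule bit_fps_square_nth)
  also have "\<dots> = (if 4 dvd n then f $ (n div 4) else 0)"
    unfolding bit_fps_square_nth d by (auto simp flip: div_mult2_eq)
  finally show ?thesis .
qed

text \<open>Each factor satisfies (1 - q^m)^2 = 1 - q^(2m) modulo 2, and squaring passes to the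
  limit.\<close>

lemma euler_prod_double_bit:
  assumes "k \<ge> 1"
  shows "euler_prod (2 * k) = (euler_prod k :: bit fps)\<^sup>2"
proof (rule LIMSEQ_unique)
  show "(\<lambda>N. (\<Prod>j\<in>{1..N}. (1 - fps_X ^ (k * j)))\<^sup>2) \<longlonglongrightarrow> (euler_prod k :: bit fps)\<^sup>2"
    by (intro tendsto_power_fps tendsto_euler_prod[OF assms] filterlim_ident)
  have "(\<Prod>j\<in>{1..N}. (1 - fps_X ^ (k * j)))\<^sup>2 = (\<Prod>j\<in>{1..N}. (1 - fps_X ^ (2 * k * j)) :: bit fps)" for N
    by (simp add: bit_fps_diff bit_fps_square_add prod_power_distrib mult_ac flip: power_mult)
  then show "(\<lambda>N. (\<Prod>j\<in>{1..N}. (1 - fps_X ^ (k * j)))\<^sup>2) \<longlonglongrightarrow> (euler_prod (2 * k) :: bit fps)"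
    using tendsto_euler_prod[OF _ filterlim_ident, of "2 * k", where ?'a = bit] assms by simp
qed

section \<open>Theta series as Euler products modulo 2\<close>

lemma prod_group_4:
  fixes f :: "nat \<Rightarrow> 'a::comm_monoid_mult"
  shows "(\<Prod>j\<in>{1..4*N}. f j) = (\<Prod>i<N. f (4*i+1) * f (4*i+2) * f (4*i+3) * f (4*i+4))"
  by (induction N) (simp_all add: eval_nat_numeral mult_ac)

lemma prod_group_5:
  fixes f :: "nat \<Rightarrow> 'a::comm_monoid_mult"
  shows "(\<Prod>j\<in>{1..5*N}. f j) = (\<Prod>i<N. f (5*i+1) * f (5*i+2) * f (5*i+3) * f (5*i+4) * f (5*i+5))"
  by (induction N) (simp_all add: eval_nat_numeral mult_ac)

lemma prod_group_2:
  fixes f :: "nat \<Rightarrow> 'a::comm_monoid_mult"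
  shows "(\<Prod>j\<in>{1..2*N}. f j) = (\<Prod>i<N. f (2*i+1) * f (2*i+2))"
  by (induction N) (simp_all add: eval_nat_numeral mult_ac)

lemma filterlim_mult_nat: "m \<ge> 1 \<Longrightarrow> filterlim (\<lambda>N::nat. m * N) at_top sequentially"
  by (rule filterlim_at_top_mono[OF filterlim_ident]) simp

lemma euler_prod_nonzero [simp]: "(euler_prod k :: 'a::comm_ring_1 fps) \<noteq> 0"
  using euler_prod_nth_0[of k, where ?'a = 'a] by auto

text \<open>Modulo 2 the theta factors are those of f_k with odd index, so theta times f_(2k) is
  f_(4k) f_k. Replacing f_(2k) by f_k^2 and f_(4k) by f_k^4 leaves f_k^3.\<close>

lemma theta_eq_cube_bit:
  assumes "k \<ge> 1"
  shows "theta k (3 * k) = (euler_prod k :: bit fps) ^ 3"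
proof -
  define W where "W N = (\<Prod>j<N. (1 + fps_X ^ (k + (k + 3 * k) * j)) * (1 + fps_X ^ (3 * k + (k + 3 * k) * j)) :: bit fps)" for N
  have 1: "(\<lambda>N. euler_prod (k + 3 * k) * W N) \<longlonglongrightarrow> theta k (3 * k)"
    unfolding W_def using assms by (intro jacobi_triple_fps) auto
  have 2: "(\<lambda>N. \<Prod>j\<in>{1..2*N}. (1 - fps_X ^ (2 * k * j))) \<longlonglongrightarrow> (euler_prod (2 * k) :: bit fps)"
    using assms by (intro tendsto_euler_prod filterlim_mult_nat) auto
  have 3: "(\<lambda>N. \<Prod>j\<in>{1..4*N}. (1 - fps_X ^ (k * j))) \<longlonglongrightarrow> (euler_prod k :: bit fps)"
    using assms by (intro tendsto_euler_prod filterlim_mult_nat) auto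
  have 4: "(\<Prod>j\<in>{1..4*N}. (1 - fps_X ^ (k * j))) = W N * (\<Prod>j\<in>{1..2*N}. (1 - fps_X ^ (2 * k * j)))" for N
    unfolding prod_group_2 prod_group_4 W_def prod.distrib[symmetric]
    by (intro prod.cong refl) (simp add: bit_fps_diff algebra_simps)
  have "theta k (3 * k) * euler_prod (2 * k) = euler_prod (k + 3 * k) * (euler_prod k :: bit fps)"
  proof (rule LIMSEQ_unique)
    show "(\<lambda>N. (euler_prod (k + 3 * k) * W N) * (\<Prod>j\<in>{1..2*N}. (1 - fps_X ^ (2 * k * j)))) \<longlonglongrightarrow> theta k (3 * k) * (euler_prod (2 * k) :: bit fps)"
      by (rule tendsto_mult_fps[OF 1 2])
    show "(\<lambda>N. (euler_prod (k + 3 * k) * W N) * (\<Prod>j\<in>{1..2*N}. (1 - fps_X ^ (2 * k * j)))) \<longlonglongrightarrow> euler_prod (k + 3 * k) * (euler_prod k :: bit fps)"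
      using tendsto_mult_fps[OF tendsto_const 3] unfolding 4 by (simp add: mult.assoc)
  qed
  moreover have "euler_prod (k + 3 * k) = (euler_prod k :: bit fps) ^ 4"
    using euler_prod_double_bit[of "2 * k"] euler_prod_double_bit[of k] assms by (simp flip: power_mult)
  ultimately have "theta k (3 * k) * (euler_prod k)\<^sup>2 = euler_prod k ^ 3 * (euler_prod k :: bit fps)\<^sup>2"
    using euler_prod_double_bit[of k] assms by (simp flip: power_add power_Suc2)
  then show ?thesis by (subst (asm) mult_right_cancel) simp_all
qed

text \<open>The factors of f_1 are sorted by index modulo 5: residues 1, 4 go to \<open>W\<close>,
  residues 2, 3 to \<open>W'\<close>, and the multiples of 5 form f_5.\<close>

lemma theta_mult_bit: "theta 1 4 * theta 2 3 = (euler_prod 1 * euler_prod 5 :: bit fps)"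
proof -
  define W where "W N = (\<Prod>j<N. (1 + fps_X ^ (1 + (1 + 4) * j)) * (1 + fps_X ^ (4 + (1 + 4) * j)) :: bit fps)" for N
  define W' where "W' N = (\<Prod>j<N. (1 + fps_X ^ (2 + (2 + 3) * j)) * (1 + fps_X ^ (3 + (2 + 3) * j)) :: bit fps)" for N
  let ?E = "euler_prod 5 :: bit fps"
  have 1: "(\<lambda>N. ?E * W N) \<longlonglongrightarrow> theta 1 4"
    using jacobi_triple_fps[of 1 4, where ?'a = bit] by (simp add: W_def)
  have 2: "(\<lambda>N. ?E * W' N) \<longlonglongrightarrow> theta 2 3"
    using jacobi_triple_fps[of 2 3, where ?'a = bit] by (simp add: W'_def)
  have 3: "(\<lambda>N. \<Prod>j\<in>{1..N}. (1 - fps_X ^ (5 * j))) \<longlonglongrightarrow> ?E"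
    by (intro tendsto_euler_prod filterlim_ident) auto
  have 4: "(\<lambda>N. \<Prod>j\<in>{1..5*N}. (1 - fps_X ^ (1 * j))) \<longlonglongrightarrow> (euler_prod 1 :: bit fps)"
    by (intro tendsto_euler_prod filterlim_mult_nat) auto
  have 5: "(\<Prod>j\<in>{1..5*N}. (1 - fps_X ^ (1 * j))) = W N * W' N * (\<Prod>j\<in>{1..N}. (1 - fps_X ^ (5 * j)))" for N
    unfolding prod_group_5 W_def W'_def
    unfolding One_nat_def prod.atLeast1_atMost_eq prod.distrib[symmetric]
    by (intro prod.cong refl) (simp add: bit_fps_diff mult_ac add_ac)
  have "theta 1 4 * theta 2 3 * ?E = ?E * ?E * euler_prod 1"
  proof (rule LIMSEQ_unique)
    show "(\<lambda>N. (?E * W N) * (?E * W' N) * (\<Prod>j\<in>{1..N}. (1 - fps_X ^ (5 * j)))) \<longlonglongrightarrow> theta 1 4 * theta 2 3 * ?E"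
      by (intro tendsto_mult_fps 1 2 3)
    show "(\<lambda>N. (?E * W N) * (?E * W' N) * (\<Prod>j\<in>{1..N}. (1 - fps_X ^ (5 * j)))) \<longlonglongrightarrow> ?E * ?E * euler_prod 1"
      using tendsto_mult_fps[OF tendsto_const 4, of "?E * ?E"] unfolding 5 by (simp add: mult_ac)
  qed
  then have "(theta 1 4 * theta 2 3) * ?E = (euler_prod 1 * ?E) * ?E"
    by (simp only: mult_ac)
  then show ?thesis by (subst (asm) mult_right_cancel) simp_all
qed

lemma euler_prod_1_5_bit:
  "(euler_prod 1 * euler_prod 5 :: bit fps) = euler_prod 1 ^ 6 + fps_X * euler_prod 5 ^ 6"
proof -
  have "(euler_prod 1 ^ 3)\<^sup>2 = euler_prod 1 * euler_prod 5 + fps_X * (euler_prod 5 ^ 3 :: bit fps)\<^sup>2"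
    using theta_quintic_identity[where ?'a = bit] theta_eq_cube_bit[of 1] theta_eq_cube_bit[of 5]
    unfolding theta_mult_bit by simp
  then have "euler_prod 1 ^ 6 = euler_prod 1 * euler_prod 5 + fps_X * (euler_prod 5 ^ 6 :: bit fps)"
    by (simp flip: power_mult)
  then show ?thesis by (simp add: add.assoc)
qed

section \<open>Parity of the coefficients\<close>

text \<open>One integer series has both the rational series and its reduction modulo 2 as
  images.\<close>

definition fps_map_of_int :: "int fps \<Rightarrow> 'a::comm_ring_1 fps" where
  "fps_map_of_int f = Abs_fps (\<lambda>n. of_int (f $ n))"

lemma fps_map_of_int_nth [simp]: "fps_map_of_int f $ n = of_int (f $ n)"
  by (simp add: fps_map_of_int_def)

lemma fps_map_of_int_mult: "fps_map_of_int (f * g) = fps_map_of_int f * fps_map_of_int g"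
  by (simp add: fps_eq_iff fps_mult_nth)

lemma fps_map_of_int_1: "fps_map_of_int 1 = 1"
  by (simp add: fps_eq_iff)

lemma fps_map_of_int_power: "fps_map_of_int (f ^ n) = fps_map_of_int f ^ n"
  by (induction n) (simp_all add: fps_map_of_int_1 fps_map_of_int_mult)

lemma fps_map_of_int_prod: "fps_map_of_int (\<Prod>i\<in>A. f i) = (\<Prod>i\<in>A. fps_map_of_int (f i))"
  by (induction A rule: infinite_finite_induct) (simp_all add: fps_map_of_int_1 fps_map_of_int_mult)

lemma fps_map_of_int_euler_prod: "fps_map_of_int (euler_prod k) = (euler_prod k :: 'a::comm_ring_1 fps)"
proof (rule fps_ext)
  fix n
  have "fps_map_of_int (1 - fps_X ^ m) = (1 - fps_X ^ m :: 'a fps)" for m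
    by (simp add: fps_eq_iff)
  then have "(\<Prod>j\<in>{1..n}. (1 - fps_X ^ (k * j) :: 'a fps)) = fps_map_of_int (\<Prod>j\<in>{1..n}. 1 - fps_X ^ (k * j))"
    by (simp add: fps_map_of_int_prod)
  then show "fps_map_of_int (euler_prod k) $ n = (euler_prod k :: 'a fps) $ n"
    by (simp add: euler_prod_def)
qed

lemma QP_eq: "QP k = fps_to_fls (fps_map_of_int (euler_prod k))"
  unfolding fps_map_of_int_euler_prod by (simp add: QP_def qpoch_def euler_prod_def)

lemma even_int_of_int: "even_int (of_int x) \<longleftrightarrow> (of_int x :: bit) = 0"
proof -
  have "(of_int x :: bit) = 0 \<longleftrightarrow> even x"
    by (cases "even x") (auto elim!: evenE oddE)
  moreover have "even_int (of_int x) \<longleftrightarrow> even x"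
    unfolding even_int_def by (metis dvd_def of_int_eq_iff)
  ultimately show ?thesis by simp
qed

text \<open>A series with constant term 1 is invertible over the integers. The first equation can
  then be reduced modulo 2, the second evaluates the rational quotient.\<close>

lemma fps_int_quotient:
  fixes f g :: "int fps"
  assumes "g $ 0 = 1"
  obtains h where "h * g = f"
    "fps_to_fls (fps_map_of_int f) / fps_to_fls (fps_map_of_int g) = (fps_to_fls (fps_map_of_int h) :: rat fls)"
proof
  let ?h = "f * fps_right_inverse g 1"
  have "g * fps_right_inverse g 1 = 1"
    by (rule fps_right_inverse) (simp add: assms)
  then show h: "?h * g = f" by (simp add: mult_ac)
  have "(fps_map_of_int g :: rat fps) $ 0 \<noteq> 0" using assms by simp
  then have "(fps_map_of_int g :: rat fps) \<noteq> 0" by (metis fps_zero_nth)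
  moreover have "fps_map_of_int f = (fps_map_of_int ?h * fps_map_of_int g :: rat fps)"
    by (simp add: h flip: fps_map_of_int_mult)
  ultimately show "fps_to_fls (fps_map_of_int f) / fps_to_fls (fps_map_of_int g) = (fps_to_fls (fps_map_of_int ?h) :: rat fls)"
    by (simp add: fls_times_fps_to_fls)
qed

text \<open>Dividing \<open>K\<close> by f_5^6 gives F = q + (f_1/f_5)^6; multiplying it by f_1^2 /
  f_5^4 gives the formula for (f_1/f_5)^3. The witness is G = f_1^2 / f_5.\<close>

lemma bit_quotient_dissection:
  fixes F :: "bit fps"
  assumes "F * euler_prod 5 ^ 5 = euler_prod 1"
  obtains G where "F = fps_X + (G ^ 4 + fps_X * (euler_prod 1 * euler_prod 5)\<^sup>2)\<^sup>2"
proof -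
  let ?A = "euler_prod 1 :: bit fps" and ?B = "euler_prod 5 :: bit fps"
  have K: "?A * ?B = ?A ^ 6 + fps_X * ?B ^ 6" by (rule euler_prod_1_5_bit)
  obtain I where I: "?B * I = 1"
    using inverse_mult_eq_1'[of ?B] euler_prod_nth_0[of 5, where ?'a = bit] by auto
  have BI: "?B ^ n * I ^ n = 1" for n by (simp add: I flip: power_mult_distrib)
  have "?A ^ 3 * ?B = ?A\<^sup>2 * (?A * ?B)" by (simp add: eval_nat_numeral)
  also have "\<dots> = ?A ^ 8 + fps_X * ?A\<^sup>2 * ?B ^ 6" unfolding K by (simp add: eval_nat_numeral algebra_simps)
  finally have 3: "?A ^ 3 * ?B = ?A ^ 8 + fps_X * ?A\<^sup>2 * ?B ^ 6" .
  have "(?A\<^sup>2 * I) ^ 4 + fps_X * (?A * ?B)\<^sup>2 = ?A ^ 8 * I ^ 4 + fps_X * ?A\<^sup>2 * ?B\<^sup>2 * (?B ^ 4 * I ^ 4)"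
    unfolding BI by (simp add: power_mult_distrib mult_ac flip: power_mult)
  also have "\<dots> = (?A ^ 8 + fps_X * ?A\<^sup>2 * ?B ^ 6) * I ^ 4"
    by (simp add: eval_nat_numeral algebra_simps)
  also have "\<dots> = ?A ^ 3 * I ^ 3 * (?B * I)"
    unfolding 3[symmetric] by (simp add: eval_nat_numeral mult_ac)
  finally have H: "(?A\<^sup>2 * I) ^ 4 + fps_X * (?A * ?B)\<^sup>2 = (?A * I) ^ 3"
    by (simp add: I power_mult_distrib)
  have "F = F * ?B ^ 5 * I ^ 5"
    using BI[of 5] by (simp add: mult.assoc)
  also have "\<dots> = ?A * I ^ 5 * (?B * I)" unfolding assms I by simp
  also have "\<dots> = (?A * ?B) * I ^ 6" by (simp add: eval_nat_numeral mult_ac)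
  also have "\<dots> = fps_X * (?B ^ 6 * I ^ 6) + ?A ^ 6 * I ^ 6"
    unfolding K by (simp add: algebra_simps)
  also have "\<dots> = fps_X + ((?A * I) ^ 3)\<^sup>2"
    unfolding BI by (simp add: power_mult_distrib flip: power_mult)
  finally show thesis
    unfolding H[symmetric] by (rule that)
qed

text \<open>Beyond q itself, F has only even exponents. Halving 8 n + 4 leaves 4 n + 2, where
  neither a fourth power (multiples of 4) nor q times a square (odd exponents) contributes.\<close>

lemma bit_quotient_nth:
  fixes F :: "bit fps"
  assumes "F * euler_prod 5 ^ 5 = euler_prod 1" "n \<ge> 1"
  shows "F $ (2 * n + 1) = 0" "F $ (8 * n + 4) = 0"
proof -
  obtain G where F: "F = fps_X + (G ^ 4 + fps_X * (euler_prod 1 * euler_prod 5)\<^sup>2)\<^sup>2"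
    using assms(1) by (rule bit_quotient_dissection)
  show "F $ (2 * n + 1) = 0"
    using assms(2) unfolding F by (simp add: bit_fps_square_nth)
  have h: "(8 * n + 4) div 2 = 4 * n + 2" by simp
  have "\<not> 4 dvd 4 * n + 2" by presburger
  then show "F $ (8 * n + 4) = 0"
    unfolding F fps_add_nth bit_fps_square_nth[of _ "8 * n + 4"] h bit_fps_power4_nth
    by (simp add: bit_fps_square_nth)
qed

text \<open>Modulo 2, f_2 = f_1^2 and f_10 = f_5^2, so the eta quotient reduces to f_1 /
  f_5^5.\<close>

lemma J10_parity:
  obtains F where "F * euler_prod 5 ^ 5 = (euler_prod 1 :: bit fps)"
    "\<And>m. m \<ge> 1 \<Longrightarrow> even_int (J10 m) \<longleftrightarrow> F $ (m + 1) = 0"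
proof -
  obtain h :: "int fps" where h: "h * (euler_prod 1 * euler_prod 10 ^ 5) = euler_prod 2 * euler_prod 5 ^ 5"
    "fps_to_fls (fps_map_of_int (euler_prod 2 * euler_prod 5 ^ 5)) / fps_to_fls (fps_map_of_int (euler_prod 1 * euler_prod 10 ^ 5)) = (fps_to_fls (fps_map_of_int h) :: rat fls)"
    by (rule fps_int_quotient[of "euler_prod 1 * euler_prod 10 ^ 5" "euler_prod 2 * euler_prod 5 ^ 5"])
      (simp_all add: euler_prod_nth_0 fps_power_zeroth)
  let ?A = "euler_prod 1 :: bit fps" and ?B = "euler_prod 5 :: bit fps"
  have j: "j10 = fls_X_inv * fps_to_fls (fps_map_of_int h) - 1"
    unfolding j10_def QP_eq h(2)[symmetric]
    by (simp add: fps_map_of_int_mult fps_map_of_int_power fls_times_fps_to_fls fps_to_fls_power)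
  \<comment> \<open>The factor 1/q shifts the index by one; m \<ge> 1 keeps clear of the constant
    -1.\<close>
  have "J10 m = of_int (h $ (m + 1))" if "m \<ge> 1" for m
    using that by (simp add: J10_def j fls_X_inv_times_conv_shift nat_add_distrib)
  then have J: "even_int (J10 m) \<longleftrightarrow> (fps_map_of_int h :: bit fps) $ (m + 1) = 0" if "m \<ge> 1" for m
    using that by (simp add: even_int_of_int)
  have "fps_map_of_int h * (?A * (?B\<^sup>2) ^ 5) = ?A\<^sup>2 * ?B ^ 5"
    using arg_cong[OF h(1), of "fps_map_of_int :: _ \<Rightarrow> bit fps"] euler_prod_double_bit[of 1] euler_prod_double_bit[of 5]
    by (simp add: fps_map_of_int_mult fps_map_of_int_power fps_map_of_int_euler_prod)
  then have "(fps_map_of_int h * ?B ^ 5) * (?A * ?B ^ 5) = ?A * (?A * ?B ^ 5)"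
    by (simp add: eval_nat_numeral mult_ac)
  then have "fps_map_of_int h * ?B ^ 5 = ?A"
    by (subst (asm) mult_right_cancel) simp_all
  then show thesis using J by (rule that)
qed

text \<open>The constant 4 affects degree 0 only and the last summand carries the factor 16. The
  rest is a fourth power divided by q, which modulo 2 lives in degrees m with 4 dividing m +
  1.\<close>

lemma J10star_parity:
  assumes "m \<ge> 1" "\<not> 4 dvd m + 1"
  shows "even_int (J10star m)"
proof -
  obtain h :: "int fps" where h:
    "fps_to_fls (fps_map_of_int (euler_prod 1 * euler_prod 5)) / fps_to_fls (fps_map_of_int (euler_prod 2 * euler_prod 10)) = (fps_to_fls (fps_map_of_int h) :: rat fls)"
    by (rule fps_int_quotient[of "euler_prod 2 * euler_prod 10" "euler_prod 1 * euler_prod 5"])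
      (simp_all add: euler_prod_nth_0)
  obtain h' :: "int fps" where h':
    "fps_to_fls (fps_map_of_int (euler_prod 2 * euler_prod 10)) / fps_to_fls (fps_map_of_int (euler_prod 1 * euler_prod 5)) = (fps_to_fls (fps_map_of_int h') :: rat fls)"
    by (rule fps_int_quotient[of "euler_prod 1 * euler_prod 5" "euler_prod 2 * euler_prod 10"])
      (simp_all add: euler_prod_nth_0)
  have j: "j10star = fls_X_inv * fps_to_fls (fps_map_of_int (h ^ 4)) + 4 + 2 ^ 4 * (fls_X * fps_to_fls (fps_map_of_int (h' ^ 4)))"
    unfolding j10star_def QP_eq fps_map_of_int_power fps_to_fls_power h[symmetric] h'[symmetric]
    by (simp add: fps_map_of_int_mult fls_times_fps_to_fls)
  have n4: "(4 :: rat fls) $$ int m = 0"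
    using assms(1) by simp
  have n16: "((2 :: rat fls) ^ 4 * f) $$ k = 16 * f $$ k" for f k
    by simp
  \<comment> \<open>The coefficient 16 is written as 2 times 8, which vanishes visibly in
    \<open>bit\<close>.\<close>
  have "J10star m = of_int ((h ^ 4) $ (m + 1) + 2 * (8 * (h' ^ 4) $ (m - 1)))"
    using assms(1) unfolding J10star_def j fls_plus_nth n4 n16
    by (simp add: fls_X_inv_times_conv_shift fls_X_times_conv_shift nat_add_distrib nat_diff_distrib)
  moreover have "(of_int ((h ^ 4) $ (m + 1) + 2 * (8 * (h' ^ 4) $ (m - 1))) :: bit) = (fps_map_of_int h ^ 4) $ (m + 1)"
    by (simp flip: fps_map_of_int_power)
  ultimately show ?thesis
    using assms(2) by (simp only: even_int_of_int bit_fps_power4_nth if_False)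
qed

theorem theorem4p5:
  fixes n :: nat
  assumes "n \<ge> 1"
  shows "even_int (J10 (2 * n)) \<and> even_int (J10 (8 * n + 3))
         \<and> (\<forall>i::nat \<in> {0, 1, 2}. even_int (J10star (4 * n + i)))"
proof (intro conjI ballI)
  obtain F where F: "F * euler_prod 5 ^ 5 = (euler_prod 1 :: bit fps)"
    "\<And>m. m \<ge> 1 \<Longrightarrow> even_int (J10 m) \<longleftrightarrow> F $ (m + 1) = 0"
    using J10_parity by blast
  have e: "8 * n + 3 + 1 = 8 * n + 4" by simp
  show "even_int (J10 (2 * n))" "even_int (J10 (8 * n + 3))"
    using bit_quotient_nth[OF F(1) assms] F(2)[of "2 * n"] F(2)[of "8 * n + 3"] assms
    unfolding e by simp_all
  fix i :: nat assume "i \<in> {0, 1, 2}"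
  then have "\<not> 4 dvd 4 * n + i + 1" by (auto; presburger)
  then show "even_int (J10star (4 * n + i))"
    using assms by (intro J10star_parity) auto
qed

end
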